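(* Let $n,m\ge 1$ and $r\ge 0$ be integers with $r<m$. If $m\le n$ and $k=m-r$, then $$N(n,m-r,m;r)=mn-m(m-r-1).$$
   Context: For a nonnegative integer $s$, $[s]=\{1,\dots,s\}$. An $r\text{-ECBC}(n,k,m)$ (erasure combinatorial batch code with redundancy $r$, with at most one item read from each server) is a multifamily $\mathcal{B}=\{B_1,\dots,B_m\}$ of $m$ subsets of $[n]$ such that for each $Y\subseteq[n]$ with $|Y|\le k$ and each $J\subseteq[m]$ with $|J|\ge m-r$ there exist subsets $C_j\subseteq B_j$ ($j\in J$) with $|C_j|\le 1$ and $Y=\bigcup_{j\in J}C_j$. Its weight is $N(\mathcal{B})=|B_1|+\cdots+|B_m|$. $N(n,k,m;r)$ denotes the minimum weight of an $r\text{-ECBC}(n,k,m)$. *)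

theory Defs
  imports Main
begin

text \<open>
  A multifamily of \<open>m\<close> subsets of \<open>[n]\<close> is an indexed family \<open>B 1, \<dots>, B m\<close>, so repetitions
  are allowed; the values of \<open>B\<close> outside \<open>{1..m}\<close> are irrelevant.
\<close>

definition is_ecbc :: "nat \<Rightarrow> nat \<Rightarrow> nat \<Rightarrow> nat \<Rightarrow> (nat \<Rightarrow> nat set) \<Rightarrow> bool" where
  "is_ecbc r n k m B \<longleftrightarrow>
     (\<forall>j\<in>{1..m}. B j \<subseteq> {1..n}) \<and>
     (\<forall>Y J. Y \<subseteq> {1..n} \<and> card Y \<le> k \<and> J \<subseteq> {1..m} \<and> int (card J) \<ge> int m - int r \<longrightarrow>
        (\<exists>C. (\<forall>j\<in>J. C j \<subseteq> B j \<and> card (C j) \<le> 1) \<and> Y = (\<Union>j\<in>J. C j)))"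

definition weight :: "nat \<Rightarrow> (nat \<Rightarrow> nat set) \<Rightarrow> nat" where
  "weight m B = (\<Sum>j=1..m. card (B j))"

text \<open>
  The minimum is unspecified when no such code exists, so an equation for \<open>min_weight\<close> can
  only be proved where the minimum is attained.
\<close>

definition min_weight :: "nat \<Rightarrow> nat \<Rightarrow> nat \<Rightarrow> nat \<Rightarrow> nat" where
  "min_weight n k m r = (LEAST w. \<exists>B. is_ecbc r n k m B \<and> w = weight m B)"

end

theory Submission imports Defs "HOL-Library.Infinite_Set" begin

text \<open>
  Put \<open>k = m - r\<close>; the claimed minimum is \<open>m * (n - k + 1)\<close>, that is, \<open>n - k + 1\<close> items per server.

  Fewer items on one server are impossible: if server \<open>j\<close> lacked \<open>k\<close> items, then after an erasure
  that leaves \<open>j\<close> and \<open>k - 1\<close> other servers those \<open>k\<close> items would have to be read from the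
  \<open>k - 1\<close> others (\<open>ecbc_card_ge\<close>).

  For the converse place the items and the servers on the same circle of length \<open>n\<close>, which is
  possible because \<open>m \<le> n\<close>, and let server \<open>j\<close> store the arc of \<open>n - k + 1\<close> items starting at \<open>j\<close>.
  For \<open>k\<close> surviving servers and \<open>k\<close> requested items one needs a bijection that moves every
  server forward by at most \<open>n - k\<close>. By the cycle lemma the circle can be cut open so that every
  initial segment contains at least as many servers as items. Pairing the \<open>i\<close>-th server with
  the \<open>i\<close>-th item after the cut then never moves backwards. It never moves too far either: \<open>i\<close>
  servers precede the \<open>i\<close>-th server and its partner (counting from \<open>0\<close>), and \<open>k - 1 - i\<close> items
  follow the partner, so at most \<open>n - k\<close> steps remain between the two.
\<close>

section \<open>The lower bound for a single server\<close>

lemma ecbc_card_ge: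
  assumes code: "is_ecbc r n (m - r) m B" and r: "r < m" and le: "m - r \<le> n" and j: "j \<in> {1..m}"
  shows "n - (m - r) + 1 \<le> card (B j)"
proof (rule ccontr)
  let ?k = "m - r"
  assume "\<not> ?thesis"
  moreover have sub: "B j \<subseteq> {1..n}"
    using code j by (simp add: is_ecbc_def)
  moreover from sub have "card ({1..n} - B j) = n - card (B j)"
    by (simp add: card_Diff_subset finite_subset)
  ultimately have "?k \<le> card ({1..n} - B j)"
    using le by linarith
  then obtain Y where Y: "Y \<subseteq> {1..n} - B j" "card Y = ?k"
    by (meson obtain_subset_with_card_n)
  have "?k - 1 \<le> card ({1..m} - {j})"
    using j by simp
  then obtain J where J: "J \<subseteq> {1..m} - {j}" "card J = ?k - 1" "finite J"
    by (meson obtain_subset_with_card_n)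
  have "card (insert j J) = ?k"
    using J r by (subst card_insert_disjoint) auto
  moreover have "insert j J \<subseteq> {1..m}"
    using J j by auto
  ultimately have "Y \<subseteq> {1..n} \<and> card Y \<le> ?k \<and> insert j J \<subseteq> {1..m} \<and>
      int (card (insert j J)) \<ge> int m - int r"
    using Y r by auto
  with code have "\<exists>C. (\<forall>i\<in>insert j J. C i \<subseteq> B i \<and> card (C i) \<le> 1) \<and> Y = (\<Union>i\<in>insert j J. C i)"
    unfolding is_ecbc_def by presburger
  then obtain C
    where C: "\<And>i. i \<in> insert j J \<Longrightarrow> C i \<subseteq> B i \<and> card (C i) \<le> 1"
      and YC: "Y = (\<Union>i\<in>insert j J. C i)"
    by auto
  have "C j = {}"
    using C[of j] YC Y(1) by auto
  then have "Y = (\<Union>i\<in>J. C i)"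
    using YC by simp
  then have "card Y \<le> (\<Sum>i\<in>J. card (C i))"
    using J(3) by (simp add: card_UN_le)
  also have "\<dots> \<le> card J"
    using sum_mono[of J "\<lambda>i. card (C i)" "\<lambda>_. 1"] C by simp
  finally show False
    using Y(2) J(2) r by simp
qed

section \<open>Matching points on a circle\<close>

text \<open>
  The bound by \<open>n - k\<close> comes from counting within \<open>{1..n}\<close>: the \<open>i\<close>-th element (from \<open>0\<close>) of a
  \<open>k\<close>-subset lies between \<open>i + 1\<close> and \<open>n - k + i + 1\<close>.
\<close>

lemma matching_if_ballot:
  fixes J Y :: "nat set"
  assumes J: "J \<subseteq> {1..n}" "card J = k" and Y: "Y \<subseteq> {1..n}" "card Y = k"
    and ballot: "\<And>p. p \<le> n \<Longrightarrow> card (Y \<inter> {..p}) \<le> card (J \<inter> {..p})"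
  shows "\<exists>g. bij_betw g J Y \<and> (\<forall>j\<in>J. j \<le> g j \<and> g j \<le> j + (n - k))"
proof -
  have enum: "\<exists>e. strict_mono_on {..<k} e \<and> bij_betw e {..<k} S"
    if S: "S \<subseteq> {1..n}" "card S = k" for S
  proof -
    have fin: "finite S"
      using S(1) finite_subset by blast
    from finite_enumerate[OF this] obtain e :: "nat \<Rightarrow> nat"
      where e: "strict_mono_on {..<k} e" "\<forall>i<k. e i \<in> S"
      using S(2) by auto
    have inj: "inj_on e {..<k}"
      using e(1) strict_mono_on_imp_inj_on by blast
    then have "e ` {..<k} = S"
      using e(2) S(2) fin by (intro card_subset_eq) (auto simp: card_image)
    with inj e(1) show ?thesis
      by (auto simp: bij_betw_def)
  qed
  obtain a where a: "strict_mono_on {..<k} a" "bij_betw a {..<k} J"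
    using enum[OF J] by blast
  obtain b where b: "strict_mono_on {..<k} b" "bij_betw b {..<k} Y"
    using enum[OF Y] by blast
  have aJ: "a i \<in> J" and bY: "b i \<in> Y" if "i < k" for i
    using that a(2) b(2) by (auto simp: bij_betw_def)
  have a_inj: "inj_on a {..<k}" and b_inj: "inj_on b {..<k}"
    using a(2) b(2) by (auto simp: bij_betw_def)
  have a_le: "a i \<le> a i'" and b_le: "b i \<le> b i'" if "i \<le> i'" "i' < k" for i i'
    using that a(1) b(1) by (auto simp: strict_mono_on_def le_less)
  have lower: "Suc i \<le> a i" if i: "i < k" for i
  proof -
    have "card (a ` {..i}) = Suc i"
      using i card_image[OF inj_on_subset[OF a_inj, of "{..i}"]] by force
    moreover have "a i' \<in> {1..a i}" if "i' \<le> i" for i'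
      using that i a_le[of i' i] aJ[of i'] J(1) by auto
    then have "a ` {..i} \<subseteq> {1..a i}"
      by auto
    ultimately show ?thesis
      using card_mono[of "{1..a i}" "a ` {..i}"] by simp
  qed
  have upper: "k - i \<le> Suc n - b i" if i: "i < k" for i
  proof -
    have "card (b ` {i..<k}) = k - i"
      using i card_image[OF inj_on_subset[OF b_inj, of "{i..<k}"]] by force
    moreover have "b i' \<in> {b i..n}" if "i \<le> i'" "i' < k" for i'
      using that b_le[of i i'] bY[of i'] Y(1) by auto
    then have "b ` {i..<k} \<subseteq> {b i..n}"
      by auto
    ultimately show ?thesis
      using card_mono[of "{b i..n}" "b ` {i..<k}"] by simp
  qed
  have ab: "a i \<le> b i" if i: "i < k" for i
  proof (rule ccontr)
    assume less: "\<not> a i \<le> b i"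
    have "card (b ` {..i}) = Suc i"
      using i card_image[OF inj_on_subset[OF b_inj, of "{..i}"]] by force
    moreover have "b i' \<in> Y \<inter> {..b i}" if "i' \<le> i" for i'
      using that i b_le[of i' i] bY[of i'] by auto
    then have "b ` {..i} \<subseteq> Y \<inter> {..b i}"
      by auto
    ultimately have "Suc i \<le> card (Y \<inter> {..b i})"
      using card_mono[of "Y \<inter> {..b i}" "b ` {..i}"] by simp
    also have "\<dots> \<le> card (J \<inter> {..b i})"
      by (rule ballot) (use bY[OF i] Y(1) in auto)
    also have "\<dots> \<le> card (a ` {..<i})"
    proof (rule card_mono)
      show "J \<inter> {..b i} \<subseteq> a ` {..<i}"
      proof
        fix x assume x: "x \<in> J \<inter> {..b i}"
        then obtain i' where i': "x = a i'" "i' < k"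
          using a(2) by (auto simp: bij_betw_def)
        then have "i' < i"
          using a_le[of i i'] x less by force
        then show "x \<in> a ` {..<i}"
          using i' by blast
      qed
    qed simp
    also have "\<dots> \<le> i"
      using card_image_le[of "{..<i}" a] by simp
    finally show False
      by simp
  qed
  let ?g = "b \<circ> the_inv_into {..<k} a"
  have "bij_betw ?g J Y"
    using a(2) b(2) bij_betw_the_inv_into bij_betw_trans by blast
  moreover have "j \<le> ?g j \<and> ?g j \<le> j + (n - k)" if jJ: "j \<in> J" for j
  proof -
    obtain i where i: "j = a i" "i < k"
      using jJ a(2) by (auto simp: bij_betw_def)
    have "?g j = b i"
      using i a_inj by (simp add: the_inv_into_f_f)
    moreover have "b i \<le> n"
      using bY[OF i(2)] Y(1) by auto
    ultimately show ?thesis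
      using i ab[of i] lower[of i] upper[of i] by auto
  qed
  ultimately show ?thesis
    by blast
qed

text \<open>
  The cycle lemma: cutting the circle after a point \<open>c\<close> at which the excess \<open>F\<close> of servers over
  items is least makes all excesses counted from the cut nonnegative. The map \<open>rot\<close> gives the
  positions relative to the cut.
\<close>

lemma cyclic_matching:
  fixes J Y :: "nat set"
  assumes J: "J \<subseteq> {1..n}" "card J = k" and Y: "Y \<subseteq> {1..n}" "card Y = k"
  shows "\<exists>g. bij_betw g J Y \<and> (\<forall>j\<in>J. (g j + n - j) mod n \<le> n - k)"
proof -
  define F where "F p = int (card (J \<inter> {..p})) - int (card (Y \<inter> {..p}))" for p
  obtain c where c: "c \<le> n" "\<And>p. p \<le> n \<Longrightarrow> F c \<le> F p"
  proof -
    have "Min (F ` {..n}) \<in> F ` {..n}"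
      by (intro Min_in) auto
    then obtain c where "c \<le> n" "F c = Min (F ` {..n})"
      by (metis atMost_iff imageE)
    then show ?thesis
      using that[of c] by auto
  qed
  define rot where "rot x = (if x \<le> c then x + n - c else x - c)" for x
  have rot_inj: "inj_on rot {1..n}"
    using c(1) by (auto simp: inj_on_def rot_def split: if_splits)
  have rot_range: "rot ` S \<subseteq> {1..n}" if "S \<subseteq> {1..n}" for S
    using that c(1) by (fastforce simp: rot_def split: if_splits)
  have rot_card: "card (rot ` S) = card S" if "S \<subseteq> {1..n}" for S
    using that rot_inj by (meson card_image inj_on_subset)
  have rot_count: "int (card (rot ` S \<inter> {..p})) =
      (if p \<le> n - c then int (card (S \<inter> {..c + p})) - int (card (S \<inter> {..c}))
       else int (card S) - int (card (S \<inter> {..c})) + int (card (S \<inter> {..p - (n - c)})))"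
    if S: "S \<subseteq> {1..n}" and p: "p \<le> n" for S p
  proof -
    have fin: "finite S"
      using S finite_subset by blast
    have "rot ` S \<inter> {..p} = rot ` {x \<in> S. rot x \<le> p}"
      by auto
    then have count: "card (rot ` S \<inter> {..p}) = card {x \<in> S. rot x \<le> p}"
      using rot_card[of "{x \<in> S. rot x \<le> p}"] S by auto
    show ?thesis
    proof (cases "p \<le> n - c")
      case True
      have "{x \<in> S. rot x \<le> p} = S \<inter> {..c + p} - S \<inter> {..c}"
        using True c(1) S by (fastforce simp: rot_def split: if_splits)
      moreover have "card (S \<inter> {..c}) \<le> card (S \<inter> {..c + p})"
        using fin by (intro card_mono) auto
      moreover have "card (S \<inter> {..c + p} - S \<inter> {..c}) = card (S \<inter> {..c + p}) - card (S \<inter> {..c})"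
        using fin by (intro card_Diff_subset) auto
      ultimately show ?thesis
        using True count by simp
    next
      case False
      have "{x \<in> S. rot x \<le> p} = (S - S \<inter> {..c}) \<union> (S \<inter> {..p - (n - c)})"
        using False c(1) S p by (fastforce simp: rot_def split: if_splits)
      moreover have "card ((S - S \<inter> {..c}) \<union> (S \<inter> {..p - (n - c)}))
          = card (S - S \<inter> {..c}) + card (S \<inter> {..p - (n - c)})"
        using fin False c(1) p by (intro card_Un_disjoint) auto
      moreover have "card (S - S \<inter> {..c}) = card S - card (S \<inter> {..c})"
        using fin by (intro card_Diff_subset) auto
      moreover have "card (S \<inter> {..c}) \<le> card S"
        using fin by (intro card_mono) auto
      ultimately show ?thesis
        using False count by simp
    qed
  qed
  have "card (rot ` Y \<inter> {..p}) \<le> card (rot ` J \<inter> {..p})" if p: "p \<le> n" for p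
  proof (cases "p \<le> n - c")
    case True
    then have "F c \<le> F (c + p)"
      using c by simp
    then show ?thesis
      using True rot_count[OF J(1) p] rot_count[OF Y(1) p] by (simp add: F_def)
  next
    case False
    have "F c \<le> F (p - (n - c))"
      using c p by simp
    then show ?thesis
      using False rot_count[OF J(1) p] rot_count[OF Y(1) p] J(2) Y(2) by (simp add: F_def)
  qed
  then have "\<exists>h. bij_betw h (rot ` J) (rot ` Y) \<and> (\<forall>x\<in>rot ` J. x \<le> h x \<and> h x \<le> x + (n - k))"
    using rot_range rot_card J Y by (intro matching_if_ballot) simp_all
  then obtain h where h: "bij_betw h (rot ` J) (rot ` Y)"
      and h_arc: "\<And>x. x \<in> rot ` J \<Longrightarrow> x \<le> h x \<and> h x \<le> x + (n - k)"
    by blast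
  have rot_bij: "bij_betw rot S (rot ` S)" if "S \<subseteq> {1..n}" for S
    using that rot_inj by (auto simp: bij_betw_def intro: inj_on_subset)
  let ?g = "the_inv_into Y rot \<circ> (h \<circ> rot)"
  have g: "bij_betw ?g J Y"
    using h rot_bij[OF J(1)] bij_betw_the_inv_into[OF rot_bij[OF Y(1)]] bij_betw_trans by blast
  moreover have "(?g j + n - j) mod n \<le> n - k" if j: "j \<in> J" for j
  proof -
    define y where "y = ?g j"
    have "y \<in> Y"
      using g j by (auto simp: y_def bij_betw_def)
    then have yn: "y \<in> {1..n}" and jn: "j \<in> {1..n}"
      using Y(1) j J(1) by auto
    have "h (rot j) \<in> rot ` Y"
      using h j by (auto simp: bij_betw_def)
    then have "rot y = h (rot j)"
      using rot_bij[OF Y(1)] by (simp add: y_def f_the_inv_into_f bij_betw_def)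
    then have le: "rot j \<le> rot y" "rot y \<le> rot j + (n - k)"
      using h_arc[of "rot j"] j by auto
    have "rot y - rot j < n"
      using rot_range[of "{y, j}"] yn jn by auto
    \<comment> \<open>Rotating changes the difference of two points by a multiple of \<open>n\<close> only.\<close>
    moreover have "y + n - j = rot y - rot j \<or> y + n - j = rot y - rot j + n"
      using le(1) yn jn c(1) unfolding rot_def by (auto split: if_splits)
    ultimately have "(y + n - j) mod n = rot y - rot j"
      by auto
    then show ?thesis
      using le(2) by (simp add: y_def)
  qed
  ultimately show ?thesis
    by blast
qed

section \<open>The cyclic code\<close>

definition cyclic_arc :: "nat \<Rightarrow> nat \<Rightarrow> nat \<Rightarrow> nat set" where
  "cyclic_arc n l j = {y \<in> {1..n}. (y + n - j) mod n \<le> l}"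

lemma card_cyclic_arc_le:
  assumes "j \<le> n"
  shows "card (cyclic_arc n l j) \<le> l + 1"
proof -
  have "inj_on (\<lambda>y. (y + n - j) mod n) {1..n}"
  proof (rule linorder_inj_onI)
    fix x y assume xy: "x < y" "x \<in> {1..n}" "y \<in> {1..n}"
    show "(x + n - j) mod n \<noteq> (y + n - j) mod n"
    proof
      assume "(x + n - j) mod n = (y + n - j) mod n"
      then have "n dvd (y + n - j) - (x + n - j)"
        using xy(1) assms by (subst mod_eq_dvd_iff_nat[symmetric]) auto
      then have "n dvd y - x"
        using assms xy by simp
      then show False
        using xy by (auto dest: dvd_imp_le)
    qed
  qed auto
  then have "inj_on (\<lambda>y. (y + n - j) mod n) (cyclic_arc n l j)"
    by (rule inj_on_subset) (auto simp: cyclic_arc_def)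
  then show ?thesis
    using card_inj_on_le[of _ "cyclic_arc n l j" "{..l}"] by (auto simp: cyclic_arc_def)
qed

lemma ecbc_cyclic_arc:
  assumes "r < m" and mn: "m \<le> n"
  shows "is_ecbc r n (m - r) m (cyclic_arc n (n - (m - r)))"
proof -
  let ?k = "m - r"
  let ?B = "cyclic_arc n (n - ?k)"
  have "\<exists>C. (\<forall>j\<in>J. C j \<subseteq> ?B j \<and> card (C j) \<le> 1) \<and> Y = (\<Union>j\<in>J. C j)"
    if Y: "Y \<subseteq> {1..n}" "card Y \<le> ?k" and J: "J \<subseteq> {1..m}" "int (card J) \<ge> int m - int r" for Y J
  proof -
    \<comment> \<open>Enlarge the request and shrink the set of servers until both have exactly \<open>m - r\<close> elements.\<close>
    have "?k \<le> n"
      using mn by simp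
    then obtain Y' where Y': "Y \<subseteq> Y'" "Y' \<subseteq> {1..n}" "card Y' = ?k"
      using exists_subset_between[of Y ?k "{1..n}"] Y by auto
    have "?k \<le> card J"
      using J(2) by linarith
    then obtain J' where J': "J' \<subseteq> J" "card J' = ?k"
      by (meson obtain_subset_with_card_n)
    have "J' \<subseteq> {1..n}"
      using J' J(1) mn by auto
    then obtain g where g: "bij_betw g J' Y'" "\<And>j. j \<in> J' \<Longrightarrow> (g j + n - j) mod n \<le> n - ?k"
      using cyclic_matching[of J' n ?k Y'] J' Y' by blast
    define C where "C j = (if j \<in> J' then {g j} \<inter> Y else {})" for j
    have "C j \<subseteq> ?B j \<and> card (C j) \<le> 1" for j
    proof -
      have "C j \<subseteq> ?B j"
        using g(2) Y(1) by (auto simp: C_def cyclic_arc_def)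
      moreover have "card (C j) \<le> card {g j}"
        by (rule card_mono) (auto simp: C_def)
      ultimately show ?thesis
        by simp
    qed
    moreover have "Y = (\<Union>j\<in>J. C j)"
      using g(1) Y'(1) J'(1) by (auto simp: C_def bij_betw_def split: if_splits)
    ultimately show ?thesis
      by blast
  qed
  then show ?thesis
    by (auto simp: is_ecbc_def cyclic_arc_def)
qed

section \<open>The minimum weight\<close>

theorem theorem9:
  fixes n m r k :: nat
  assumes "n \<ge> 1" and "m \<ge> 1" and "r < m"
    and "m \<le> n" and "k = m - r"
  shows "int (min_weight n k m r) = int m * int n - int m * (int m - int r - 1)"
proof -
  let ?B = "cyclic_arc n (n - k)"
  have lower: "m * (n - k + 1) \<le> weight m B" if "is_ecbc r n k m B" for B
    using sum_mono[of "{1..m}" "\<lambda>_. n - k + 1" "\<lambda>j. card (B j)"] ecbc_card_ge[of r n m B]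
      that assms by (simp add: weight_def)
  have code: "is_ecbc r n k m ?B"
    using ecbc_cyclic_arc assms by simp
  have "weight m ?B \<le> m * (n - k + 1)"
    using sum_mono[of "{1..m}" "\<lambda>j. card (?B j)" "\<lambda>_. n - k + 1"]
      card_cyclic_arc_le[of _ n "n - k"] assms(4) by (simp add: weight_def)
  with lower[OF code] have "weight m ?B = m * (n - k + 1)"
    by simp
  with code lower have "min_weight n k m r = m * (n - k + 1)"
    unfolding min_weight_def by (intro Least_equality) (auto intro: exI[of _ ?B])
  moreover have "int (n - k + 1) = int n - (int m - int r - 1)"
    using assms by simp
  ultimately show ?thesis
    by (simp only: of_nat_mult right_diff_distrib)
qed

end
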